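(* Fix $t>0$, $x_0\in\mathbb{R}$ and $\mu\in\mathbb{R}$. For $\sigma>0$ let $\gamma_{\sigma^2}$ denote the Gaussian probability measure on $\mathbb{R}$ with mean $x_0+\mu t$ and variance $\sigma^2 t$. For $n\in\mathbb{N}$ let $T_n:\mathbb{R}^n\to\mathbb{R}$ be given by $$T_n((z_k)_{1\le k\le n})=\frac{\sum_{k=1}^n (z_k-x_0-t\mu)^2}{nt}.$$ Then the estimators $T^{(0)}:\mathbb{R}^\infty\to\mathbb{R}$ and $T^{(1)}:\mathbb{R}^\infty\to\mathbb{R}$ defined by $$T^{(0)}((z_k)_{k\in\mathbb{N}})=\liminf_{n\to\infty}T_n((z_k)_{1\le k\le n})$$ and $$T^{(1)}((z_k)_{k\in\mathbb{N}})=\limsup_{n\to\infty}T_n((z_k)_{1\le k\le n})$$ are infinite-sample consistent estimators of the parameter $\sigma^2$ for the family of probability measures $(\gamma_{\sigma^2}^{\infty})_{\sigma^2>0}$.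
   Context: $\mathbb{N}=\{1,2,\dots\}$, and $\mathbb{R}^{\infty}=\mathbb{R}^{\mathbb{N}}$ is the space of real sequences with its Borel $\sigma$-algebra. For a Borel probability measure $\gamma$ on $\mathbb{R}$, $\gamma^{\infty}$ is the infinite product (power) measure on $\mathbb{R}^{\infty}$. The measure $\gamma_{\sigma^2}$ is the law at time $t$ of the Wiener process with drift $X_t=x_0+\mu t+\sigma W_t$, where $\sigma$ is called the parameter of the bombardment force. Given a family $(\gamma_\theta)_{\theta\in\Theta}$ of Borel probability measures on $\mathbb{R}$ with $\Theta\subseteq\mathbb{R}$, a Borel measurable function $T:\mathbb{R}^\infty\to\mathbb{R}$ is called an infinite-sample consistent estimator of the parameter $\theta$ for the family $(\gamma_\theta^\infty)_{\theta\in\Theta}$ if $\gamma_\theta^\infty(\{(x_k)_{k\in\mathbb{N}}\in\mathbb{R}^\infty:T((x_k)_{k\in\mathbb{N}})=\theta\})=1$ for every $\theta\in\Theta$. *)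

theory Defs
  imports "HOL-Probability.Probability"
begin

definition gaussian_measure :: "real \<Rightarrow> real \<Rightarrow> real measure" where
  "gaussian_measure m v = density lborel (\<lambda>x. ennreal (normal_density m (sqrt v) x))"
  (* v is the variance; the library's normal_density takes the standard deviation. *)

text \<open>A sequence in \<open>\<real>\<^sup>\<infinity>\<close> is a function on \<^typ>\<open>nat\<close>, so the coordinate \<open>x\<^sub>k\<close> with
  \<open>k = 1, 2, \<dots>\<close> is \<open>x (k - 1)\<close>.\<close>

definition power_measure :: "real measure \<Rightarrow> (nat \<Rightarrow> real) measure" where
  "power_measure M = (\<Pi>\<^sub>M k\<in>UNIV. M)"

text \<open>The set of parameters is \<open>\<Theta>\<close>. The measurability of \<open>T\<close> refers to the Borel sets of the
  product topology on \<^typ>\<open>nat \<Rightarrow> real\<close>, which by \<open>sets_PiM_equal_borel\<close> form the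
  \<open>\<sigma>\<close>-algebra on which the power measures live.\<close>

definition infinite_sample_consistent_estimator ::
    "real set \<Rightarrow> (real \<Rightarrow> real measure) \<Rightarrow> ((nat \<Rightarrow> real) \<Rightarrow> real) \<Rightarrow> bool" where
  "infinite_sample_consistent_estimator \<Theta> \<gamma> T \<longleftrightarrow>
     (\<forall>\<theta>\<in>\<Theta>. prob_space (\<gamma> \<theta>) \<and> sets (\<gamma> \<theta>) = sets borel) \<and>
     T \<in> borel_measurable borel \<and>
     (\<forall>\<theta>\<in>\<Theta>. emeasure (power_measure (\<gamma> \<theta>)) {x. T x = \<theta>} = 1)"

definition T_sample :: "real \<Rightarrow> real \<Rightarrow> real \<Rightarrow> nat \<Rightarrow> (nat \<Rightarrow> real) \<Rightarrow> real" where
  "T_sample t x0 \<mu> n z = (\<Sum>k<n. (z k - x0 - t * \<mu>)\<^sup>2) / (real n * t)"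

text \<open>The lower and upper limits are taken in the extended reals, as they can be infinite.
  \<^const>\<open>real_of_ereal\<close> maps infinite values to \<open>0\<close>, which is not a positive variance, so
  an infinite limit never counts as a correct estimate.\<close>

definition T_liminf :: "real \<Rightarrow> real \<Rightarrow> real \<Rightarrow> (nat \<Rightarrow> real) \<Rightarrow> real" where
  "T_liminf t x0 \<mu> z = real_of_ereal (liminf (\<lambda>n. ereal (T_sample t x0 \<mu> n z)))"

definition T_limsup :: "real \<Rightarrow> real \<Rightarrow> real \<Rightarrow> (nat \<Rightarrow> real) \<Rightarrow> real" where
  "T_limsup t x0 \<mu> z = real_of_ereal (limsup (\<lambda>n. ereal (T_sample t x0 \<mu> n z)))"

end

theory Submission
  imports Defs
begin

text \<open>Under \<open>\<gamma>\<^sup>\<infinity>\<close> the centred squares \<open>(z\<^sub>k - m)\<^sup>2 - \<sigma>\<^sup>2t\<close> are independent with mean zero and finite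
  fourth moment, so Cantelli's form of the strong law of large numbers applies to them: the fourth
  moment of a partial sum of \<open>n\<close> terms is \<open>O(n\<^sup>2)\<close>, hence the fourth powers of the averages have a
  summable expectation and are almost surely summable, and the averages tend to zero. Lower and
  upper limit then both agree with the limit \<open>\<sigma>\<^sup>2\<close>.\<close>

section \<open>Fourth moments of sums of independent variables\<close>

text \<open>A lower power of \<open>\<bar>x\<bar>\<close> is at most \<open>1\<close> on the unit
  interval and at most \<open>x ^ 4\<close> outside it. The bounds make \<open>1 + x ^ 4\<close> a
  dominating function for all lower moments.\<close>

lemma one_plus_power4_bounds:
  fixes x :: real
  shows "x\<^sup>2 \<le> 1 + x ^ 4" "\<bar>x\<bar> \<le> 1 + x ^ 4" "\<bar>x\<bar> ^ 3 \<le> 1 + x ^ 4"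
proof -
  have *: "\<bar>x\<bar> ^ j \<le> 1 + \<bar>x\<bar> ^ 4" if "j \<le> 4" for j
  proof (cases "\<bar>x\<bar> \<le> 1")
    case True
    have "\<bar>x\<bar> ^ j \<le> 1" using True by (simp add: power_le_one)
    then show ?thesis by (simp add: add_increasing2)
  next
    case False
    then have "\<bar>x\<bar> ^ j \<le> \<bar>x\<bar> ^ 4" using that by (intro power_increasing) auto
    then show ?thesis by linarith
  qed
  show "x\<^sup>2 \<le> 1 + x ^ 4" "\<bar>x\<bar> \<le> 1 + x ^ 4" "\<bar>x\<bar> ^ 3 \<le> 1 + x ^ 4"
    using *[of 2] *[of 1] *[of 3] by (simp_all add: power_even_abs)
qed

lemma (in finite_measure) integrable_power_of_power4:
  fixes X :: "'a \<Rightarrow> real"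
  assumes [measurable]: "X \<in> borel_measurable M" and X4: "integrable M (\<lambda>\<omega>. X \<omega> ^ 4)"
  shows "integrable M X" "integrable M (\<lambda>\<omega>. X \<omega> ^ 2)" "integrable M (\<lambda>\<omega>. X \<omega> ^ 3)"
proof -
  have dom: "integrable M (\<lambda>\<omega>. 1 + X \<omega> ^ 4)" using X4 by simp
  show "integrable M X" "integrable M (\<lambda>\<omega>. X \<omega> ^ 2)" "integrable M (\<lambda>\<omega>. X \<omega> ^ 3)"
    by (rule Bochner_Integration.integrable_bound[OF dom];
        simp add: power_abs one_plus_power4_bounds)+
qed

text \<open>Expand the powers of the sum: independence factors every mixed moment, and a term
  containing \<open>X\<close> or \<open>Y\<close> to the first power vanishes because the means are
  zero. Of the mixed terms of degree four only the middle one survives, with its binomial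
  coefficient 6.\<close>

lemma (in prob_space) indep_var_add_centred_moments:
  fixes X Y :: "'a \<Rightarrow> real"
  assumes indep: "indep_var borel X borel Y"
    and X4: "integrable M (\<lambda>\<omega>. X \<omega> ^ 4)" and Y4: "integrable M (\<lambda>\<omega>. Y \<omega> ^ 4)"
    and EX: "expectation X = 0" and EY: "expectation Y = 0"
  shows "integrable M (\<lambda>\<omega>. (X \<omega> + Y \<omega>) ^ 4)"
    "expectation (\<lambda>\<omega>. X \<omega> + Y \<omega>) = 0"
    "expectation (\<lambda>\<omega>. (X \<omega> + Y \<omega>) ^ 2) = expectation (\<lambda>\<omega>. X \<omega> ^ 2) + expectation (\<lambda>\<omega>. Y \<omega> ^ 2)"
    "expectation (\<lambda>\<omega>. (X \<omega> + Y \<omega>) ^ 4) = expectation (\<lambda>\<omega>. X \<omega> ^ 4) +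
       6 * (expectation (\<lambda>\<omega>. X \<omega> ^ 2) * expectation (\<lambda>\<omega>. Y \<omega> ^ 2)) + expectation (\<lambda>\<omega>. Y \<omega> ^ 4)"
proof -
  have [measurable]: "X \<in> borel_measurable M" "Y \<in> borel_measurable M"
    using indep_var_rv1[OF indep] indep_var_rv2[OF indep] by auto
  note iX = integrable_power_of_power4[OF _ X4, simplified]
  note iY = integrable_power_of_power4[OF _ Y4, simplified]
  have indep': "indep_var borel (\<lambda>\<omega>. X \<omega> ^ i) borel (\<lambda>\<omega>. Y \<omega> ^ j)" for i j
    using indep_var_compose[OF indep, of "\<lambda>x. x ^ i" borel "\<lambda>x. x ^ j" borel] by (simp add: comp_def)
  have int: "integrable M (\<lambda>\<omega>. X \<omega> ^ i)" "integrable M (\<lambda>\<omega>. Y \<omega> ^ i)" if "i \<in> {1, 2, 3}" for i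
    using that iX iY by auto
  \<comment> \<open>The exponents 1, 2, 3 cover all mixed terms; the fourth moments control each
    factor.\<close>
  have iXY: "integrable M (\<lambda>\<omega>. X \<omega> ^ i * Y \<omega> ^ j)"
    and eXY: "expectation (\<lambda>\<omega>. X \<omega> ^ i * Y \<omega> ^ j) = expectation (\<lambda>\<omega>. X \<omega> ^ i) * expectation (\<lambda>\<omega>. Y \<omega> ^ j)"
    if "i \<in> {1, 2, 3}" "j \<in> {1, 2, 3}" for i j
    using indep_var_integrable[OF indep' int(1)[OF that(1)] int(2)[OF that(2)]]
      indep_var_lebesgue_integral[OF indep' int(1)[OF that(1)] int(2)[OF that(2)]] by auto
  note i11 = iXY[of 1 1, simplified] and i13 = iXY[of 1 3, simplified]
    and i31 = iXY[of 3 1, simplified] and i22 = iXY[of 2 2, simplified]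
  note e11 = eXY[of 1 1, simplified] and e13 = eXY[of 1 3, simplified]
    and e31 = eXY[of 3 1, simplified] and e22 = eXY[of 2 2, simplified]
  have exp4: "(X \<omega> + Y \<omega>) ^ 4 = X \<omega> ^ 4 + 4 * (X \<omega> ^ 3 * Y \<omega>) + 6 * (X \<omega> ^ 2 * Y \<omega> ^ 2)
      + 4 * (X \<omega> * Y \<omega> ^ 3) + Y \<omega> ^ 4" for \<omega>
    by algebra
  have exp2: "(X \<omega> + Y \<omega>) ^ 2 = X \<omega> ^ 2 + 2 * (X \<omega> * Y \<omega>) + Y \<omega> ^ 2" for \<omega>
    by algebra
  show "integrable M (\<lambda>\<omega>. (X \<omega> + Y \<omega>) ^ 4)"
    unfolding exp4 using X4 Y4 i31 i22 i13 by simp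
  show "expectation (\<lambda>\<omega>. X \<omega> + Y \<omega>) = 0"
    using iX iY EX EY by simp
  show "expectation (\<lambda>\<omega>. (X \<omega> + Y \<omega>) ^ 2) = expectation (\<lambda>\<omega>. X \<omega> ^ 2) + expectation (\<lambda>\<omega>. Y \<omega> ^ 2)"
    unfolding exp2 using iX iY i11 e11 EX EY by simp
  show "expectation (\<lambda>\<omega>. (X \<omega> + Y \<omega>) ^ 4) = expectation (\<lambda>\<omega>. X \<omega> ^ 4) +
       6 * (expectation (\<lambda>\<omega>. X \<omega> ^ 2) * expectation (\<lambda>\<omega>. Y \<omega> ^ 2)) + expectation (\<lambda>\<omega>. Y \<omega> ^ 4)"
    unfolding exp4 using X4 Y4 i31 i22 i13 e13 e31 e22 EX EY by simp
qed

text \<open>A new summand raises the fourth moment by at most \<open>C\<close> plus a multiple of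
  the second moment of the partial sum, which is linear in \<open>n\<close>; summing these
  increments gives quadratic growth.\<close>

lemma (in prob_space) indep_vars_sum_power4_le:
  fixes X :: "nat \<Rightarrow> 'a \<Rightarrow> real"
  assumes indep: "indep_vars (\<lambda>_. borel) X UNIV"
    and X4: "\<And>i. integrable M (\<lambda>\<omega>. X i \<omega> ^ 4)"
    and EX: "\<And>i. expectation (X i) = 0"
    and C: "\<And>i. expectation (\<lambda>\<omega>. X i \<omega> ^ 4) \<le> C"
  shows "integrable M (\<lambda>\<omega>. (\<Sum>i<n. X i \<omega>) ^ 4) \<and>
    expectation (\<lambda>\<omega>. (\<Sum>i<n. X i \<omega>) ^ 4) \<le> 3 * (1 + C)\<^sup>2 * (real n)\<^sup>2"
proof -
  have rv [measurable]: "X i \<in> borel_measurable M" for i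
    using indep by (auto simp: indep_vars_def)
  have "0 \<le> expectation (\<lambda>\<omega>. X 0 \<omega> ^ 4)" by (intro integral_nonneg_AE) auto
  then have C0: "0 \<le> C" using C[of 0] by linarith
  have X2: "expectation (\<lambda>\<omega>. X i \<omega> ^ 2) \<le> 1 + C" for i
  proof -
    have "expectation (\<lambda>\<omega>. X i \<omega> ^ 2) \<le> expectation (\<lambda>\<omega>. 1 + X i \<omega> ^ 4)"
      using X4[of i]
      by (intro integral_mono integrable_power_of_power4(2) one_plus_power4_bounds(1)) simp_all
    also have "\<dots> = 1 + expectation (\<lambda>\<omega>. X i \<omega> ^ 4)" using X4 by (simp add: prob_space)
    finally show ?thesis using C[of i] by linarith
  qed
  let ?S = "\<lambda>n \<omega>. \<Sum>i<n. X i \<omega>"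
  \<comment> \<open>The induction also carries the mean and the second moment of the partial sum,
    since both enter the fourth moment at the next step.\<close>
  have "integrable M (\<lambda>\<omega>. ?S n \<omega> ^ 4) \<and> expectation (?S n) = 0 \<and>
    expectation (\<lambda>\<omega>. ?S n \<omega> ^ 2) \<le> real n * (1 + C) \<and>
    expectation (\<lambda>\<omega>. ?S n \<omega> ^ 4) \<le> 3 * (1 + C)\<^sup>2 * (real n)\<^sup>2"
  proof (induction n)
    case 0
    show ?case by simp
  next
    case (Suc n)
    have "indep_vars (\<lambda>_. borel) X (insert n {..<n})"
      using indep_vars_subset[OF indep] by blast
    then have "indep_var borel (X n) borel (?S n)"
      by (intro indep_vars_sum) auto
    note m = indep_var_add_centred_moments[OF this X4 _ EX]
    have S: "?S (Suc n) \<omega> = X n \<omega> + ?S n \<omega>" for \<omega> by simp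
    let ?a = "expectation (\<lambda>\<omega>. X n \<omega> ^ 2)" and ?b = "expectation (\<lambda>\<omega>. ?S n \<omega> ^ 2)"
    have "?a * ?b \<le> (1 + C) * (real n * (1 + C))"
      using X2[of n] Suc C0 by (intro mult_mono) auto
    \<comment> \<open>Enlarging \<open>C\<close> this way makes the increment
      \<open>3 * (1 + C)^2 * (2 * n + 1)\<close>, which completes the square to
      \<open>(n + 1)^2\<close>.\<close>
    moreover have "C \<le> 3 * (1 + C)\<^sup>2"
      using C0 by (simp add: power2_eq_square algebra_simps)
    ultimately have "expectation (\<lambda>\<omega>. X n \<omega> ^ 4) + 6 * (?a * ?b) + expectation (\<lambda>\<omega>. ?S n \<omega> ^ 4)
      \<le> 3 * (1 + C)\<^sup>2 + 6 * ((1 + C) * (real n * (1 + C))) + 3 * (1 + C)\<^sup>2 * (real n)\<^sup>2"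
      using C[of n] Suc by linarith
    also have "\<dots> = 3 * (1 + C)\<^sup>2 * (real (Suc n))\<^sup>2"
      by (simp add: power2_eq_square algebra_simps)
    finally have "expectation (\<lambda>\<omega>. X n \<omega> ^ 4) + 6 * (?a * ?b) + expectation (\<lambda>\<omega>. ?S n \<omega> ^ 4)
      \<le> 3 * (1 + C)\<^sup>2 * (real (Suc n))\<^sup>2" .
    moreover have "?a + ?b \<le> real (Suc n) * (1 + C)"
      using X2[of n] Suc by (simp add: algebra_simps)
    ultimately show ?case
      unfolding S using m Suc by auto
  qed
  then show ?thesis by blast
qed

section \<open>Cantelli's strong law\<close>

theorem (in prob_space) strong_law_of_large_numbers_power4:
  fixes X :: "nat \<Rightarrow> 'a \<Rightarrow> real"
  assumes indep: "indep_vars (\<lambda>_. borel) X UNIV"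
    and X4: "\<And>i. integrable M (\<lambda>\<omega>. X i \<omega> ^ 4)"
    and EX: "\<And>i. expectation (X i) = 0"
    and C: "\<And>i. expectation (\<lambda>\<omega>. X i \<omega> ^ 4) \<le> C"
  shows "AE \<omega> in M. (\<lambda>n. (\<Sum>i<n. X i \<omega>) / real n) \<longlonglongrightarrow> 0"
proof -
  have rv [measurable]: "X i \<in> borel_measurable M" for i
    using indep by (auto simp: indep_vars_def)
  note S = indep_vars_sum_power4_le[OF indep X4 EX C]
  let ?A = "\<lambda>n \<omega>. (\<Sum>i<n. X i \<omega>) / real n"
  let ?K = "\<lambda>n. 3 * (1 + C)\<^sup>2 * inverse ((real n)\<^sup>2)"
  have nn: "(\<integral>\<^sup>+\<omega>. ennreal (?A n \<omega> ^ 4) \<partial>M) \<le> ennreal (?K n)" for n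
  proof -
    have "(\<integral>\<^sup>+\<omega>. ennreal (?A n \<omega> ^ 4) \<partial>M) = ennreal (expectation (\<lambda>\<omega>. ?A n \<omega> ^ 4))"
      using S[of n] by (intro nn_integral_eq_integral) (auto simp: power_divide)
    also have "expectation (\<lambda>\<omega>. ?A n \<omega> ^ 4) = expectation (\<lambda>\<omega>. (\<Sum>i<n. X i \<omega>) ^ 4) / real n ^ 4"
      by (simp add: power_divide)
    also have "\<dots> \<le> 3 * (1 + C)\<^sup>2 * (real n)\<^sup>2 / real n ^ 4"
      using S[of n] by (intro divide_right_mono) auto
    \<comment> \<open>At \<open>n = 0\<close> both sides are 0, by the convention for division by
      zero.\<close>
    also have "\<dots> = ?K n" by (cases "n = 0") (simp_all add: divide_simps power2_eq_square power4_eq_xxxx)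
    finally show ?thesis by (simp add: ennreal_leI)
  qed
  have "summable ?K"
    using inverse_power_summable[of 2, where 'a = real] by (intro summable_mult) simp
  then have fin: "(\<Sum>n. ennreal (?K n)) < \<infinity>"
    by (subst suminf_ennreal2) auto
  \<comment> \<open>Sum and integral commute for nonnegative terms, and a nonnegative function with
    finite integral is finite almost everywhere.\<close>
  have "(\<integral>\<^sup>+\<omega>. (\<Sum>n. ennreal (?A n \<omega> ^ 4)) \<partial>M) = (\<Sum>n. \<integral>\<^sup>+\<omega>. ennreal (?A n \<omega> ^ 4) \<partial>M)"
    by (intro nn_integral_suminf) measurable
  also have "\<dots> \<le> (\<Sum>n. ennreal (?K n))"
    by (intro suminf_le nn) auto
  finally have "(\<integral>\<^sup>+\<omega>. (\<Sum>n. ennreal (?A n \<omega> ^ 4)) \<partial>M) \<noteq> \<infinity>"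
    using fin by (metis infinity_ennreal_def leD)
  then have "AE \<omega> in M. (\<Sum>n. ennreal (?A n \<omega> ^ 4)) \<noteq> \<infinity>"
    by (intro nn_integral_PInf_AE) measurable
  then show ?thesis
  proof eventually_elim
    case (elim \<omega>)
    have "summable (\<lambda>n. ?A n \<omega> ^ 4)"
      using elim by (intro summable_suminf_not_top) auto
    then have "(\<lambda>n. root 4 (?A n \<omega> ^ 4)) \<longlonglongrightarrow> root 4 0"
      by (intro tendsto_real_root summable_LIMSEQ_zero)
    \<comment> \<open>An even root recovers only the absolute value, which suffices for convergence
      to zero.\<close>
    moreover have "root 4 (x ^ 4) = \<bar>x\<bar>" for x :: real
      using root_abs_power[of 4 x] by (simp add: power_even_abs)
    ultimately show ?case
      by (intro tendsto_rabs_zero_cancel[where f = "\<lambda>n. ?A n \<omega>"]) (simp del: abs_divide)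
  qed
qed

section \<open>Infinite powers of a measure\<close>

lemma prob_space_power_measure: "prob_space M \<Longrightarrow> prob_space (power_measure M)"
  unfolding power_measure_def by (intro prob_space_PiM)

text \<open>Independence means that the joint law is the product of the marginals. Here the joint
  map is the identity and each marginal is \<open>M\<close>.\<close>

lemma indep_vars_power_measure_coordinates:
  assumes "prob_space M"
  shows "prob_space.indep_vars (power_measure M) (\<lambda>_. M) (\<lambda>k x. x k) UNIV"
proof -
  interpret P: prob_space "power_measure M"
    by (rule prob_space_power_measure[OF assms])
  have "distr (power_measure M) M (\<lambda>x. x k) = M" for k
    unfolding power_measure_def using assms by (intro distr_PiM_component) auto
  moreover have "(\<lambda>x. x k) \<in> measurable (power_measure M) M" for k
    unfolding power_measure_def by measurable
  moreover have "distr (power_measure M) (power_measure M) (\<lambda>x. x) = power_measure M"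
    by (rule distr_id)
  ultimately show ?thesis
    by (subst P.indep_vars_iff_distr_eq_PiM') (simp_all add: restrict_UNIV flip: power_measure_def)
qed

text \<open>The variables \<open>f (x k)\<close> are independent with the law of \<open>f\<close>
  under \<open>M\<close>, so their moments are computed on \<open>M\<close> and the fourth moment of
  \<open>f\<close> serves as the common bound.\<close>

theorem AE_power_measure_sample_mean:
  fixes f :: "real \<Rightarrow> real"
  assumes M: "prob_space M" and [measurable]: "f \<in> borel_measurable M"
    and f4: "integrable M (\<lambda>x. f x ^ 4)" and Ef: "integral\<^sup>L M f = 0"
  shows "AE x in power_measure M. (\<lambda>n. (\<Sum>k<n. f (x k)) / real n) \<longlonglongrightarrow> 0"
proof -
  interpret P: prob_space "power_measure M"
    by (rule prob_space_power_measure[OF M])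
  have coord [measurable]: "(\<lambda>x. x k) \<in> measurable (power_measure M) M" for k
    unfolding power_measure_def by measurable
  have distr: "distr (power_measure M) M (\<lambda>x. x k) = M" for k
    unfolding power_measure_def using M by (intro distr_PiM_component) auto
  show ?thesis
  proof (rule P.strong_law_of_large_numbers_power4)
    show "P.indep_vars (\<lambda>_. borel) (\<lambda>k x. f (x k)) UNIV"
      by (rule P.indep_vars_compose2[OF indep_vars_power_measure_coordinates[OF M]]) simp
    show "integrable (power_measure M) (\<lambda>x. f (x k) ^ 4)" for k
      using f4 by (subst integrable_distr_eq[symmetric, OF coord]) (simp_all add: distr)
    show "P.expectation (\<lambda>x. f (x k)) = 0" for k
      using Ef by (subst integral_distr[symmetric, OF coord]) (simp_all add: distr)
    show "P.expectation (\<lambda>x. f (x k) ^ 4) \<le> integral\<^sup>L M (\<lambda>x. f x ^ 4)" for k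
      by (subst integral_distr[symmetric, OF coord]) (simp_all add: distr)
  qed
qed

section \<open>Gaussian samples\<close>

lemma prob_space_gaussian_measure: "0 < v \<Longrightarrow> prob_space (gaussian_measure m v)"
  unfolding gaussian_measure_def by (intro prob_space_normal_density) simp

text \<open>The fourth power is a polynomial of degree 8 in \<open>x - m\<close>, and a Gaussian has
  moments of every order; the mean vanishes because the second central moment is the variance
  \<open>v\<close>.\<close>

lemma gaussian_measure_centred_square:
  assumes v: "0 < v"
  shows "integrable (gaussian_measure m v) (\<lambda>x. ((x - m)\<^sup>2 - v) ^ 4)"
    and "integral\<^sup>L (gaussian_measure m v) (\<lambda>x. (x - m)\<^sup>2 - v) = 0"
proof -
  let ?G = "gaussian_measure m v"
  interpret prob_space ?G by (rule prob_space_gaussian_measure[OF v])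
  have s: "0 < sqrt v" using v by simp
  have i: "integrable ?G (\<lambda>x. (x - m) ^ k)" for k
    unfolding gaussian_measure_def
    using integrable_normal_moment[OF s] by (subst integrable_density) auto
  have e: "integral\<^sup>L ?G (\<lambda>x. (x - m)\<^sup>2) = v"
    unfolding gaussian_measure_def
    using integral_normal_moment_even[OF s, of m 1] v by (subst integral_density) auto
  have "((x - m)\<^sup>2 - v) ^ 4 = (x - m) ^ 8 - 4 * v * (x - m) ^ 6 + 6 * v\<^sup>2 * (x - m) ^ 4
      - 4 * v ^ 3 * (x - m)\<^sup>2 + v ^ 4" for x
    by algebra
  then show "integrable ?G (\<lambda>x. ((x - m)\<^sup>2 - v) ^ 4)"
    using i by simp
  show "integral\<^sup>L ?G (\<lambda>x. (x - m)\<^sup>2 - v) = 0"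
    using i[of 2] e by (simp add: prob_space)
qed

lemma AE_T_sample_tendsto:
  assumes "0 < t" "0 < v"
  shows "AE z in power_measure (gaussian_measure (x0 + \<mu> * t) (v * t)).
    (\<lambda>n. T_sample t x0 \<mu> n z) \<longlonglongrightarrow> v"
proof -
  let ?m = "x0 + \<mu> * t"
  have vt: "0 < v * t" using assms by simp
  have "AE z in power_measure (gaussian_measure ?m (v * t)).
    (\<lambda>n. (\<Sum>k<n. (z k - ?m)\<^sup>2 - v * t) / real n) \<longlonglongrightarrow> 0"
    by (intro AE_power_measure_sample_mean prob_space_gaussian_measure
        gaussian_measure_centred_square vt) (simp add: gaussian_measure_def)
  then show ?thesis
  proof eventually_elim
    case (elim z)
    then have "(\<lambda>n. (\<Sum>k<n. (z k - ?m)\<^sup>2 - v * t) / real n / t + v) \<longlonglongrightarrow> 0 / t + v"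
      using assms by (intro tendsto_intros) auto
    \<comment> \<open>At \<open>n = 0\<close> the left side is \<open>v\<close> but
      \<open>T_sample\<close> is 0, so the two sequences agree only from 1 on.\<close>
    moreover have "(\<Sum>k<n. (z k - ?m)\<^sup>2 - v * t) / real n / t + v = T_sample t x0 \<mu> n z"
      if "0 < n" for n
      using that assms
      by (simp add: T_sample_def sum_subtractf diff_diff_eq mult.commute field_simps)
    ultimately show ?case
      by (auto elim!: Lim_transform_eventually intro: eventually_sequentiallyI[of 1])
  qed
qed

section \<open>Measurability and consistency\<close>

text \<open>With a zero denominator the quotient is constantly 0; otherwise it is continuous in
  finitely many coordinates.\<close>

lemma borel_measurable_T_sample: "T_sample t x0 \<mu> n \<in> borel_measurable borel"
  unfolding T_sample_def
  by (cases "real n * t = 0")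
     (auto intro!: borel_measurable_continuous_onI continuous_intros)

text \<open>An almost sure identity gives measure one once the event is measurable, which holds
  because the product \<sigma>-algebra is the Borel \<sigma>-algebra of the product
  topology.\<close>

lemma infinite_sample_consistent_estimatorI:
  assumes "\<And>\<theta>. \<theta> \<in> \<Theta> \<Longrightarrow> prob_space (\<gamma> \<theta>)"
    and "\<And>\<theta>. \<theta> \<in> \<Theta> \<Longrightarrow> sets (\<gamma> \<theta>) = sets borel"
    and T: "T \<in> borel_measurable borel"
    and "\<And>\<theta>. \<theta> \<in> \<Theta> \<Longrightarrow> AE x in power_measure (\<gamma> \<theta>). T x = \<theta>"
  shows "infinite_sample_consistent_estimator \<Theta> \<gamma> T"
  unfolding infinite_sample_consistent_estimator_def
proof (intro conjI ballI assms)
  fix \<theta> assume \<theta>: "\<theta> \<in> \<Theta>"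
  have "sets (power_measure (\<gamma> \<theta>)) = sets (\<Pi>\<^sub>M k\<in>UNIV. borel)"
    unfolding power_measure_def by (intro sets_PiM_cong) (auto simp: assms \<theta>)
  then have "{x. T x = \<theta>} \<in> sets (power_measure (\<gamma> \<theta>))"
    using measurable_sets[OF T, of "{\<theta>}"] by (simp add: sets_PiM_equal_borel vimage_def)
  then show "emeasure (power_measure (\<gamma> \<theta>)) {x. T x = \<theta>} = 1"
    using assms \<theta> by (intro prob_space.emeasure_eq_1_AE prob_space_power_measure) auto
qed

theorem theorem3p1p2:
  fixes t x0 \<mu> :: real
  assumes "t > 0"
  shows "infinite_sample_consistent_estimator {0<..}
           (\<lambda>v. gaussian_measure (x0 + \<mu> * t) (v * t)) (T_liminf t x0 \<mu>) \<and>
         infinite_sample_consistent_estimator {0<..}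
           (\<lambda>v. gaussian_measure (x0 + \<mu> * t) (v * t)) (T_limsup t x0 \<mu>)"
proof (intro conjI infinite_sample_consistent_estimatorI)
  note borel_measurable_T_sample [measurable]
  show "T_liminf t x0 \<mu> \<in> borel_measurable borel" "T_limsup t x0 \<mu> \<in> borel_measurable borel"
    unfolding T_liminf_def T_limsup_def by measurable
  fix v :: real assume "v \<in> {0<..}"
  then have v: "0 < v" by simp
  from AE_T_sample_tendsto[OF assms v]
  have lim: "AE z in power_measure (gaussian_measure (x0 + \<mu> * t) (v * t)).
      (\<lambda>n. ereal (T_sample t x0 \<mu> n z)) \<longlonglongrightarrow> ereal v"
    by eventually_elim (rule tendsto_ereal)
  \<comment> \<open>A convergent sequence has its limit as lower and upper limit, and
    \<open>real_of_ereal\<close> returns the finite value \<open>v\<close>. Removing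
    \<open>lim_ereal\<close> keeps the convergence in the extended reals, where these limits are
    taken.\<close>
  from lim show "AE z in power_measure (gaussian_measure (x0 + \<mu> * t) (v * t)). T_liminf t x0 \<mu> z = v"
    by eventually_elim (simp add: T_liminf_def lim_imp_Liminf[OF sequentially_bot] del: lim_ereal)
  from lim show "AE z in power_measure (gaussian_measure (x0 + \<mu> * t) (v * t)). T_limsup t x0 \<mu> z = v"
    by eventually_elim (simp add: T_limsup_def lim_imp_Limsup[OF sequentially_bot] del: lim_ereal)
qed (use assms in \<open>simp_all add: prob_space_gaussian_measure\<close>, simp_all add: gaussian_measure_def)

end
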